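(* Let $A,B,C$ be nonempty finite subsets of $\mathbb{R}\setminus\{0,-1\}$. Then $$|AB|\cdot|(A+1)C|\gg \sqrt{|A|^3\cdot|B|\cdot|C|},$$ where the implied constant is absolute.
   Context: For sets $X,Y\subset\mathbb{R}$, $XY=\{xy: x\in X, y\in Y\}$ and $X+1=\{x+1:x\in X\}$. The notation $U\gg V$ means $U\ge cV$ for some absolute constant $c>0$. *)

theory Defs
  imports Complex_Main "HOL-Library.Set_Algebras"
begin

end

theory Submission
  imports Defs
begin

text \<open>
  Put \<open>X = AB\<close> and \<open>Y = (A+1)C\<close>. For \<open>b \<in> B\<close> and \<open>c \<in> C\<close> the points \<open>(ab, (a+1)c)\<close> with
  \<open>a \<in> A\<close> are \<open>|A|\<close> points of \<open>X \<times> Y\<close> on one line, which is neither horizontal nor vertical.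
  Instead of the general Szemeredi--Trotter theorem, a cell decomposition adapted to the Cartesian
  product suffices: cut \<open>X\<close> and \<open>Y\<close> into \<open>q\<close> intervals each, of about equal cardinality. By
  monotonicity a line visits fewer than \<open>2q\<close> of the \<open>q\<^sup>2\<close> cells, so at least \<open>|A| - 2q\<close> of its
  points share a cell with a chosen other point of the line. Two points determine the line, and
  there are at most \<open>4|X|\<^sup>2|Y|\<^sup>2/q\<^sup>2\<close> pairs of points in a common cell, whence
  \<open>|B||C|(|A| - 2q)q\<^sup>2 \<le> 4|X|\<^sup>2|Y|\<^sup>2\<close>. Take \<open>q\<close> about \<open>|A|/4\<close>.
\<close>

text \<open>The index is the rank within \<open>X\<close> divided by a block length. It is defined
  on the whole type, so monotonicity survives evaluation along a line.\<close>

lemma ex_mono_equipartition: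
  fixes X :: "'a::linorder set"
  assumes "finite X" "0 < q" "q \<le> card X"
  shows "\<exists>r::'a \<Rightarrow> nat. mono r \<and> (\<forall>x\<in>X. r x < q) \<and>
           (\<forall>j. q * card {x\<in>X. r x = j} \<le> 2 * card X)"
proof -
  \<comment> \<open>Adding 1 gives \<open>q * m > card X\<close>, so indices stay below
    \<open>q\<close>; since \<open>q \<le> card X\<close>, this costs at most a factor 2.\<close>
  define m where "m = card X div q + 1"
  define rank where "rank x = card {y\<in>X. y < x}" for x
  define r where "r x = rank x div m" for x
  have m0: "0 < m" by (simp add: m_def)
  have rank_mono: "rank x \<le> rank y" if "x \<le> y" for x y
    unfolding rank_def by (rule card_mono) (use assms that in auto)
  have rank_strict: "rank x < rank y" if "x < y" "x \<in> X" for x y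
    unfolding rank_def by (rule psubset_card_mono) (use assms that in auto)
  have rank_inj: "inj_on rank X"
    by (rule inj_onI) (metis less_irrefl linorder_less_linear rank_strict)
  have rank_less: "rank x < card X" if "x \<in> X" for x
    unfolding rank_def by (rule psubset_card_mono) (use assms that in auto)
  have "card X < q * m"
    using dividend_less_div_times[OF assms(2), of "card X"] by (simp add: m_def algebra_simps)
  then have r_less: "r x < q" if "x \<in> X" for x
    using rank_less[OF that] m0 by (simp add: r_def less_mult_imp_div_less)
  have fib: "card {x\<in>X. r x = j} \<le> m" for j
  proof -
    have "rank ` {x\<in>X. r x = j} \<subseteq> {j*m..<j*m+m}"
    proof clarify
      fix x assume "j = r x"
      then show "rank x \<in> {r x * m..<r x * m + m}"
        using m0 dividend_less_div_times[of m "rank x"] by (simp add: r_def algebra_simps)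
    qed
    then have "card (rank ` {x\<in>X. r x = j}) \<le> card {j*m..<j*m+m}"
      by (intro card_mono) auto
    moreover have "inj_on rank {x\<in>X. r x = j}"
      using rank_inj by (auto simp: inj_on_def)
    ultimately show ?thesis by (simp add: card_image)
  qed
  have "q * m = q * (card X div q) + q" by (simp add: m_def)
  also have "\<dots> \<le> card X + card X" using assms(3) by (intro add_mono) simp_all
  finally have "q * m \<le> 2 * card X" by simp
  then have "q * card {x\<in>X. r x = j} \<le> 2 * card X" for j
    using fib[of j] by (meson le_trans mult_le_mono2)
  moreover have "mono r"
    unfolding r_def by (intro monoI div_le_mono rank_mono)
  ultimately show ?thesis using r_less by blast
qed

text \<open>The pairs form a chain in the product order, so the coordinate sum is injective on them,
  and the sums lie in an interval of \<open>2 * q\<close> integers. Values are integers so that an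
  antitone index can be negated before use.\<close>

lemma card_image_mono_pair_le:
  fixes f g :: "'a::linorder \<Rightarrow> int"
  assumes f: "mono_on A f" "f ` A \<subseteq> {l..<l + int q}"
    and g: "mono_on A g" "g ` A \<subseteq> {l'..<l' + int q}"
  shows "card ((\<lambda>a. (f a, g a)) ` A) \<le> 2 * q"
proof -
  let ?P = "(\<lambda>a. (f a, g a)) ` A"
  have "inj_on (\<lambda>(i, j). i + j) ?P"
  proof (rule inj_onI, clarify)
    fix a b assume "a \<in> A" "b \<in> A" "f a + g a = f b + g b"
    then show "f a = f b \<and> g a = g b"
      using mono_onD[OF f(1), of a b] mono_onD[OF g(1), of a b]
        mono_onD[OF f(1), of b a] mono_onD[OF g(1), of b a] linear[of a b]
      by linarith
  qed
  moreover have "(\<lambda>(i, j). i + j) ` ?P \<subseteq> {l + l'..<l + l' + int (2 * q)}"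
    using f(2) g(2) by fastforce
  ultimately have "card ?P \<le> card {l + l'..<l + l' + int (2 * q)}"
    by (intro card_inj_on_le) auto
  then show ?thesis by simp
qed

lemma card_cells_on_line_le:
  fixes r s :: "real \<Rightarrow> nat"
  assumes "mono r" "mono s" "finite A"
    and r: "\<And>a. a \<in> A \<Longrightarrow> r (a * b) < q" and s: "\<And>a. a \<in> A \<Longrightarrow> s ((a + 1) * c) < q"
  shows "card ((\<lambda>a. (r (a * b), s ((a + 1) * c))) ` A) \<le> 2 * q"
proof -
  define f where "f a = (if b \<ge> 0 then int (r (a * b)) else - int (r (a * b)))" for a
  define g where "g a = (if c \<ge> 0 then int (s ((a + 1) * c)) else - int (s ((a + 1) * c)))" for a
  have fm: "mono_on A f"
  proof (rule mono_onI)
    fix x y :: real assume "x \<le> y"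
    then show "f x \<le> f y"
      using monoD[OF assms(1), of "x * b" "y * b"] monoD[OF assms(1), of "y * b" "x * b"]
      by (cases "b \<ge> 0") (auto simp: f_def mult_right_mono mult_right_mono_neg)
  qed
  have gm: "mono_on A g"
  proof (rule mono_onI)
    fix x y :: real assume "x \<le> y"
    then show "g x \<le> g y"
      using monoD[OF assms(2), of "(x + 1) * c" "(y + 1) * c"]
        monoD[OF assms(2), of "(y + 1) * c" "(x + 1) * c"]
      by (cases "c \<ge> 0") (auto simp: g_def mult_right_mono mult_right_mono_neg)
  qed
  \<comment> \<open>Negated indices range over \<open>1 - q, ..., 0\<close>, so the half-open
    interval starts at \<open>1 - q\<close>.\<close>
  define l where "l = (if b \<ge> 0 then 0 else 1 - int q)"
  define l' where "l' = (if c \<ge> 0 then 0 else 1 - int q)"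
  have "f ` A \<subseteq> {l..<l + int q}" "g ` A \<subseteq> {l'..<l' + int q}"
    using r s by (fastforce simp: f_def g_def l_def l'_def)+
  then have "card ((\<lambda>a. (f a, g a)) ` A) \<le> 2 * q"
    using fm gm by (intro card_image_mono_pair_le)
  \<comment> \<open>Absolute values undo the sign changes, so the cells are an image of the signed
    pairs.\<close>
  moreover have "(\<lambda>a. (r (a * b), s ((a + 1) * c))) ` A
      = (\<lambda>(i, j). (nat \<bar>i\<bar>, nat \<bar>j\<bar>)) ` ((\<lambda>a. (f a, g a)) ` A)"
    by (auto simp: f_def g_def image_image)
  ultimately show ?thesis
    using assms(3) by (simp only:) (meson card_image_le finite_imageI le_trans)
qed

lemma two_points_determine_line:
  fixes a a' b c d d' b' c' :: real
  assumes "b \<noteq> 0" "c \<noteq> 0" "a \<noteq> a'"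
    and "a * b = d * b'" "a' * b = d' * b'"
    and "(a + 1) * c = (d + 1) * c'" "(a' + 1) * c = (d' + 1) * c'"
  shows "a = d \<and> b = b' \<and> c = c'"
proof -
  \<comment> \<open>Both \<open>b / b'\<close> and \<open>c / c'\<close> equal \<open>t\<close>, so
    one point's equations give \<open>a * t = d\<close> and \<open>(a + 1) * t = d + 1\<close>;
    subtracting forces \<open>t = 1\<close>. The shift by 1 rules out rescaling.\<close>
  define t where "t = (d - d') / (a - a')"
  have "(a - a') * b = (d - d') * b'" "(a - a') * c = (d - d') * c'"
    using assms by (simp_all add: algebra_simps)
  then have b: "b = t * b'" and c: "c = t * c'"
    using assms(3) by (simp_all add: t_def field_simps)
  have "a * t = d" "(a + 1) * t = d + 1"
    using assms b c by auto
  then have "t = 1" by (simp add: algebra_simps)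
  then show ?thesis using b c \<open>a * t = d\<close> by simp
qed

lemma card_non_representatives_ge:
  assumes "finite A"
  shows "card A - card (f ` A) \<le> card {a\<in>A. inv_into A f (f a) \<noteq> a}"
proof -
  have "{a\<in>A. inv_into A f (f a) = a} \<subseteq> inv_into A f ` f ` A" by force
  then have "card {a\<in>A. inv_into A f (f a) = a} \<le> card (f ` A)"
    using assms by (meson surj_card_le finite_imageI)
  moreover have "{a\<in>A. inv_into A f (f a) \<noteq> a} = A - {a\<in>A. inv_into A f (f a) = a}"
    by blast
  then have "card {a\<in>A. inv_into A f (f a) \<noteq> a} = card A - card {a\<in>A. inv_into A f (f a) = a}"
    using assms by (simp add: card_Diff_subset)
  ultimately show ?thesis by linarith
qed

lemma card_le_card_times_right:
  fixes A B :: "'a::field set"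
  assumes "finite A" "finite B" "b \<in> B" "b \<noteq> 0"
  shows "card A \<le> card (A * B)"
proof -
  have "(\<lambda>a. a * b) ` A \<subseteq> A * B" using assms by auto
  then show ?thesis
    using assms by (intro card_inj_on_le[of "\<lambda>a. a * b"] finite_set_times) (auto simp: inj_on_def)
qed

lemma card_lines_times_cells_le:
  fixes A B C :: "real set"
  assumes fin: "finite A" "finite B" "finite C" and nz: "0 \<notin> B" "0 \<notin> C"
    and q: "0 < q" "q \<le> card (A * B)" "q \<le> card ((\<lambda>x. x + 1) ` A * C)"
  shows "card B * card C * (card A - 2 * q) * q\<^sup>2
           \<le> 4 * (card (A * B) * card ((\<lambda>x. x + 1) ` A * C))\<^sup>2"
proof -
  define X where "X = A * B"
  define Y where "Y = (\<lambda>x. x + 1) ` A * C"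
  have finX: "finite X" "finite Y" using fin by (simp_all add: X_def Y_def finite_set_times)
  obtain r :: "real \<Rightarrow> nat" where r: "mono r" "\<And>x. x \<in> X \<Longrightarrow> r x < q"
    "\<And>j. q * card {x\<in>X. r x = j} \<le> 2 * card X"
    using ex_mono_equipartition[of X q] finX q by (auto simp: X_def)
  obtain s :: "real \<Rightarrow> nat" where s: "mono s" "\<And>y. y \<in> Y \<Longrightarrow> s y < q"
    "\<And>j. q * card {y\<in>Y. s y = j} \<le> 2 * card Y"
    using ex_mono_equipartition[of Y q] finX q by (auto simp: Y_def)
  define T where "T = Sigma (X \<times> Y) (\<lambda>p. {x\<in>X. r x = r (fst p)} \<times> {y\<in>Y. s y = s (snd p)})"
  have finT: "finite T" using finX by (auto simp: T_def)
  \<comment> \<open>\<open>T\<close> consists of the ordered pairs of grid points in a common cell.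
    Each coordinate's fibre absorbs one factor \<open>q\<close>.\<close>
  have "q\<^sup>2 * card T
      = (\<Sum>p\<in>X\<times>Y. (q * card {x\<in>X. r x = r (fst p)}) * (q * card {y\<in>Y. s y = s (snd p)}))"
    using finX
    by (simp add: T_def card_SigmaI card_cartesian_product sum_distrib_left power2_eq_square
        algebra_simps)
  also have "\<dots> \<le> (\<Sum>p\<in>X\<times>Y. (2 * card X) * (2 * card Y))"
    by (intro sum_mono mult_le_mono r s)
  also have "\<dots> = 4 * (card X * card Y)\<^sup>2"
    by (simp add: card_cartesian_product power2_eq_square)
  finally have T_le: "q\<^sup>2 * card T \<le> 4 * (card X * card Y)\<^sup>2" .

  define cell where "cell p a = (r (a * fst p), s ((a + 1) * snd p))" for p :: "real \<times> real" and a
  \<comment> \<open>One parameter is chosen per cell visited by the line \<open>p\<close>; every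
    other parameter in that cell is paired with it.\<close>
  define rep where "rep p a = inv_into A (cell p) (cell p a)" for p a
  define S where "S = Sigma (B \<times> C) (\<lambda>p. {a\<in>A. rep p a \<noteq> a})"
  have XY: "a * fst p \<in> X" "(a + 1) * snd p \<in> Y" if "a \<in> A" "p \<in> B \<times> C" for a p
    using that by (auto simp: X_def Y_def)
  have rep: "rep p a \<in> A" "cell p (rep p a) = cell p a" if "a \<in> A" for a p
    using that by (auto simp: rep_def inv_into_into f_inv_into_f)
  have non_rep: "card A - 2 * q \<le> card {a\<in>A. rep p a \<noteq> a}" if "p \<in> B \<times> C" for p
  proof -
    have "card (cell p ` A) \<le> 2 * q"
      unfolding cell_def
      by (rule card_cells_on_line_le) (use r s fin XY that in auto)
    then show ?thesis
      using card_non_representatives_ge[OF fin(1), of "cell p"] by (simp add: rep_def)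
  qed
  have "card B * card C * (card A - 2 * q) = (\<Sum>p\<in>B\<times>C. card A - 2 * q)"
    by (simp add: card_cartesian_product)
  also have "\<dots> \<le> (\<Sum>p\<in>B\<times>C. card {a\<in>A. rep p a \<noteq> a})"
    by (intro sum_mono non_rep)
  also have "\<dots> = card S"
    using fin by (simp add: S_def card_SigmaI)
  also have "card S \<le> card T"
  proof -
    define pt where "pt p a = (a * fst p, (a + 1) * snd p)" for p :: "real \<times> real" and a
    define h where "h = (\<lambda>(p, a). (pt p a, pt p (rep p a)))"
    have "h ` S \<subseteq> T"
    proof
      fix t assume "t \<in> h ` S"
      then obtain p a where pa: "p \<in> B \<times> C" "a \<in> A" and t: "t = (pt p a, pt p (rep p a))"
        by (auto simp: h_def S_def)
      then show "t \<in> T"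
        using XY[OF pa(2,1)] XY[OF rep(1)[OF pa(2)] pa(1)] rep(2)[OF pa(2), of p]
        by (simp add: T_def pt_def cell_def)
    qed
    \<comment> \<open>The two points in the image are distinct because
      \<open>a \<noteq> rep p a\<close>, so they determine both the line and the parameter
      \<open>a\<close>.\<close>
    moreover have "inj_on h S"
    proof (rule inj_onI)
      fix u v assume uv: "u \<in> S" "v \<in> S" "h u = h v"
      obtain b c a b' c' d where u: "u = ((b, c), a)" and v: "v = ((b', c'), d)"
        by (metis surj_pair)
      have "b \<noteq> 0" "c \<noteq> 0" "a \<noteq> rep (b, c) a"
        using uv(1) nz by (auto simp: u S_def)
      then show "u = v"
        using two_points_determine_line[of b c a "rep (b, c) a" d b' "rep (b', c') d" c'] uv(3)
        by (simp add: u v h_def pt_def)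
    qed
    ultimately show ?thesis using finT card_inj_on_le by blast
  qed
  finally have "card B * card C * (card A - 2 * q) * q\<^sup>2 \<le> card T * q\<^sup>2"
    by (rule mult_le_mono1)
  also have "\<dots> \<le> 4 * (card X * card Y)\<^sup>2"
    using T_le by (simp add: mult.commute)
  finally show ?thesis by (simp only: X_def Y_def)
qed

lemma cube_card_le_product_sets:
  fixes A B C :: "real set"
  assumes fin: "finite A" "finite B" "finite C" and ne: "A \<noteq> {}" "B \<noteq> {}" "C \<noteq> {}"
    and nz: "0 \<notin> A" "-1 \<notin> A" "0 \<notin> B" "0 \<notin> C"
  shows "card A ^ 3 * card B * card C
           \<le> 1024 * (card (A * B) * card ((\<lambda>x. x + 1) ` A * C))\<^sup>2"
proof -
  let ?A1 = "(\<lambda>x. x + 1) ` A"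
  define k where "k = card A"
  define x where "x = card (A * B)"
  define y where "y = card (?A1 * C)"
  obtain a b c where abc: "a \<in> A" "b \<in> B" "c \<in> C" using ne by blast
  then have nz': "a \<noteq> 0" "a + 1 \<noteq> 0" "b \<noteq> 0" "c \<noteq> 0"
    using nz by (auto simp: add_eq_0_iff2)
  have kx: "k \<le> x"
    unfolding k_def x_def using card_le_card_times_right fin abc nz' by blast
  have "card ?A1 = k" by (simp add: k_def card_image)
  then have ky: "k \<le> y"
    unfolding y_def using card_le_card_times_right[of ?A1 C c] fin abc nz' by simp
  have Bx: "card B \<le> x"
    unfolding x_def using card_le_card_times_right[of B A a] fin abc nz' by (simp add: mult.commute)
  have Cy: "card C \<le> y"
    unfolding y_def using card_le_card_times_right[of C ?A1 "a + 1"] fin abc nz'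
    by (simp add: mult.commute)
  have "k ^ 3 * card B * card C \<le> 1024 * (x * y)\<^sup>2"
  \<comment> \<open>For \<open>k < 4\<close> the choice \<open>k div 4\<close> would be 0; there the
    trivial bounds by \<open>x\<close> and \<open>y\<close> suffice.\<close>
  proof (cases "k < 4")
    case True
    have "k ^ 3 * card B * card C = k * ((k * card B) * (k * card C))"
      by (simp add: power3_eq_cube)
    also have "\<dots> \<le> 4 * ((x * x) * (y * y))"
      using True kx ky Bx Cy by (intro mult_le_mono) auto
    also have "\<dots> \<le> 1024 * (x * y)\<^sup>2" by (simp add: power2_eq_square)
    finally show ?thesis .
  next
    case False
    define q where "q = k div 4"
    \<comment> \<open>At least half of the \<open>k\<close> points on each line survive the loss of
      \<open>2 * q\<close>, while \<open>q\<close> stays comparable to \<open>k\<close>.\<close>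
    have q: "0 < q" "k \<le> 8 * q" "k \<le> 2 * (k - 2 * q)" "q \<le> k"
      using False unfolding q_def by presburger+
    have "k ^ 3 * card B * card C = card B * card C * k * (k * k)"
      by (simp add: power3_eq_cube)
    also have "\<dots> \<le> card B * card C * (2 * (k - 2 * q)) * ((8 * q) * (8 * q))"
      using q by (intro mult_le_mono) auto
    also have "\<dots> = 128 * (card B * card C * (k - 2 * q) * q\<^sup>2)"
      by (simp add: power2_eq_square)
    also have "\<dots> \<le> 128 * (4 * (x * y)\<^sup>2)"
      unfolding k_def x_def y_def
      using card_lines_times_cells_le[OF fin nz(3,4), of q] q kx ky
      by (intro mult_le_mono2) (simp add: x_def y_def)
    finally show ?thesis by simp
  qed
  then show ?thesis by (simp add: k_def x_def y_def)
qed

theorem theorem3: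
  shows "\<exists>c::real. c > 0 \<and>
    (\<forall>A B C :: real set.
       finite A \<and> A \<noteq> {} \<and> A \<subseteq> UNIV - {0, -1} \<and>
       finite B \<and> B \<noteq> {} \<and> B \<subseteq> UNIV - {0, -1} \<and>
       finite C \<and> C \<noteq> {} \<and> C \<subseteq> UNIV - {0, -1} \<longrightarrow>
       real (card (A * B)) * real (card ((\<lambda>x. x + 1) ` A * C))
         \<ge> c * sqrt (real (card A) ^ 3 * real (card B) * real (card C)))"
\<comment> \<open>The count yields 512 = 2 * 8^2 * 4, relaxed to the square 1024 = 32^2 so that the
  root is exact.\<close>
proof (intro exI[of _ "1/32"] conjI allI impI)
  fix A B C :: "real set"
  assume H: "finite A \<and> A \<noteq> {} \<and> A \<subseteq> UNIV - {0, -1} \<and>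
       finite B \<and> B \<noteq> {} \<and> B \<subseteq> UNIV - {0, -1} \<and>
       finite C \<and> C \<noteq> {} \<and> C \<subseteq> UNIV - {0, -1}"
  let ?P = "real (card (A * B)) * real (card ((\<lambda>x. x + 1) ` A * C))"
  have "card A ^ 3 * card B * card C
           \<le> 1024 * (card (A * B) * card ((\<lambda>x. x + 1) ` A * C))\<^sup>2"
    using H by (intro cube_card_le_product_sets) auto
  then have "real (card A ^ 3 * card B * card C)
      \<le> real (1024 * (card (A * B) * card ((\<lambda>x. x + 1) ` A * C))\<^sup>2)"
    by (rule of_nat_mono)
  then have "real (card A) ^ 3 * real (card B) * real (card C) \<le> (32 * ?P)\<^sup>2"
    by (simp add: power_mult_distrib)
  then have "sqrt (real (card A) ^ 3 * real (card B) * real (card C)) \<le> 32 * ?P"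
    by (intro real_le_lsqrt) auto
  then show "?P \<ge> 1/32 * sqrt (real (card A) ^ 3 * real (card B) * real (card C))"
    by simp
qed simp

end
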